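(* Let $\phi_0,g_0\in\mathrm{Mat}(m,m,\mathcal{B})$, with $g_0$ invertible, solve the Miura equation $(\bar{\mathrm{d}}g_0)\,g_0^{-1}=\mathrm{d}\phi_0$. Let $\boldsymbol{P},\boldsymbol{Q}\in\mathrm{Mat}(n,n,\mathcal{B})$ be invertible solutions of $$\bar{\mathrm{d}}\boldsymbol{P}-(\mathrm{d}\boldsymbol{P})\,\boldsymbol{P}=-[\boldsymbol{\alpha},\boldsymbol{P}],\qquad \bar{\mathrm{d}}\boldsymbol{Q}-\boldsymbol{Q}\,\mathrm{d}\boldsymbol{Q}=[\boldsymbol{\beta},\boldsymbol{Q}],$$ with $\boldsymbol{\alpha},\boldsymbol{\beta}\in\Omega^1$ (of size $n\times n$). Let $\boldsymbol{U}_0\in\mathrm{Mat}(m,n,\mathcal{B})$ and $\boldsymbol{V}_0\in\mathrm{Mat}(n,m,\mathcal{B})$ be $\mathrm{d}$- and $\bar{\mathrm{d}}$-constant, and let $\boldsymbol{X}\in\mathrm{Mat}(n,n,\mathcal{B})$ be an invertible solution of the linear equations $$\boldsymbol{X}\boldsymbol{P}-\boldsymbol{Q}\boldsymbol{X}=\boldsymbol{V}_0\boldsymbol{U}_0,\qquad \bar{\mathrm{d}}\boldsymbol{X}-(\mathrm{d}\boldsymbol{X})\,\boldsymbol{P}+(\mathrm{d}\boldsymbol{Q})\,\boldsymbol{X}=\boldsymbol{X}\boldsymbol{\alpha}+\boldsymbol{\beta}\boldsymbol{X}.$$ If $$(\mathrm{d}\phi_0)\,\boldsymbol{U}_0+\boldsymbol{U}_0\,\boldsymbol{\alpha}=0,\qquad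 \boldsymbol{V}_0\,\mathrm{d}\phi_0-\boldsymbol{\beta}\,\boldsymbol{V}_0=0,$$ then $$\phi=\phi_0+\boldsymbol{U}_0\boldsymbol{X}^{-1}\boldsymbol{V}_0,\qquad g=\big(I+\boldsymbol{U}_0(\boldsymbol{Q}\boldsymbol{X})^{-1}\boldsymbol{V}_0\big)\,g_0$$ satisfy the Miura equation $(\bar{\mathrm{d}}g)\,g^{-1}=\mathrm{d}\phi$.
   Context: $\mathcal{B}$ is a unital associative algebra, $\mathrm{Mat}(p,q,\mathcal{B})$ denotes the $p\times q$ matrices over $\mathcal{B}$, and $\mathcal{A}$ is the algebra of all finite-dimensional matrices with entries in $\mathcal{B}$, where the product of two matrices is defined to be zero if their sizes do not match. $\Omega^1$ is an $\mathcal{A}$-bimodule and $\mathrm{d},\bar{\mathrm{d}}:\mathcal{A}\to\Omega^1$ are derivations (linear maps with $\mathrm{d}(ab)=(\mathrm{d}a)b+a\,\mathrm{d}b$, and likewise for $\bar{\mathrm{d}}$) that preserve the size of matrices; an element $\omega\in\Omega^1$ has size $p\times q$ if $I_p\,\omega\,I_q=\omega$. No second-order extension of $\mathrm{d},\bar{\mathrm{d}}$ is assumed. The identity matrices $I=I_m$ and $I_n$ are $\mathrm{d}$- and $\bar{\mathrm{d}}$-constant, where $f\in\mathcal{A}$ is called $\mathrm{d}$- and $\bar{\mathrm{d}}$-constant if $\mathrm{d}f=0=\bar{\mathrm{d}}f$. $[\boldsymbol{\alpha},\boldsymbol{P}]=\boldsymbol{\alpha}\boldsymbol{P}-\boldsymbol{P}\boldsymbol{\alpha}$.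 Invertibility is in the respective algebra of square matrices; $m,n\in\mathbb{N}$ are fixed. *)

theory Defs
  imports "Jordan_Normal_Form.Matrix"
begin

section \<open>The algebra of all finite-dimensional matrices\<close>

text \<open>
  Since the sizes of matrices vary, "the algebra of all finite-dimensional matrices over B, where
  the product of matrices of non-matching sizes is zero" is the direct sum of all Mat(p,q,B).
  An element is given by its (p,q)-components, all but finitely many of which vanish.
\<close>

typedef (overloaded) 'b matalg =
  "{a :: nat \<Rightarrow> nat \<Rightarrow> 'b::zero mat.
      (\<forall>p q. a p q \<in> carrier_mat p q) \<and> finite {(p, q). a p q \<noteq> 0\<^sub>m p q}}"
  morphisms block Abs_matalg
  by (rule exI[of _ "\<lambda>p q. 0\<^sub>m p q"]) simp

setup_lifting type_definition_matalg

lemma block_carrier [simp]: "block a p q \<in> carrier_mat p q"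
  using block[of a] by auto

lemma block_dim [simp]: "dim_row (block a p q) = p" "dim_col (block a p q) = q"
  by (rule carrier_matD[OF block_carrier])+

lemma finite_block: "finite {(p, q). block a p q \<noteq> 0\<^sub>m p q}"
  using block[of a] by auto

lemma matalg_eqI:
  assumes "\<And>p q i j. i < p \<Longrightarrow> j < q \<Longrightarrow> block a p q $$ (i, j) = block b p q $$ (i, j)"
  shows "a = b"
proof -
  have "block a p q = block b p q" for p q
    by (rule eq_matI) (use assms in auto)
  then show ?thesis
    unfolding block_inject[symmetric] by (intro ext)
qed

lemma block_bound:
  obtains N where "\<And>p q. N \<le> p \<or> N \<le> q \<Longrightarrow> block a p q = 0\<^sub>m p q"
proof -
  let ?S = "{(p, q). block a p q \<noteq> 0\<^sub>m p q}"
  have f: "finite (fst ` ?S \<union> snd ` ?S)"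
    using finite_block[of a] by blast
  obtain N where N: "\<And>x. x \<in> fst ` ?S \<union> snd ` ?S \<Longrightarrow> x < N"
    using f unfolding finite_nat_set_iff_bounded by blast
  have "block a p q = 0\<^sub>m p q" if "N \<le> p \<or> N \<le> q" for p q
  proof (rule ccontr)
    assume "block a p q \<noteq> 0\<^sub>m p q"
    then have "(p, q) \<in> ?S" by simp
    then have "p \<in> fst ` ?S" "q \<in> snd ` ?S" by force+
    then have "p < N" "q < N"
      using N by blast+
    with that show False by simp
  qed
  then show ?thesis by (rule that)
qed

lemma finite_supportI:
  assumes "\<And>p q. (N::nat) \<le> p \<or> N \<le> q \<Longrightarrow> f p q = 0\<^sub>m p q"
  shows "finite {(p, q). f p q \<noteq> 0\<^sub>m p q}"
proof (rule finite_subset)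
  show "{(p, q). f p q \<noteq> 0\<^sub>m p q} \<subseteq> {..<N} \<times> {..<N}"
    using assms by (auto simp: not_le[symmetric])
qed simp

lemma Abs_block:
  assumes "\<And>p q. f p q \<in> carrier_mat p q"
    and "\<And>p q. (N::nat) \<le> p \<or> N \<le> q \<Longrightarrow> f p q = 0\<^sub>m p q"
  shows "block (Abs_matalg f) = f"
proof (rule Abs_matalg_inverse)
  have "finite {(p, q). f p q \<noteq> 0\<^sub>m p q}"
    by (rule finite_supportI) (rule assms(2))
  then show "f \<in> {a. (\<forall>p q. a p q \<in> carrier_mat p q) \<and> finite {(p, q). a p q \<noteq> 0\<^sub>m p q}}"
    using assms(1) by simp
qed

instantiation matalg :: (ab_group_add) ab_group_add
begin

lift_definition zero_matalg :: "'a matalg" is "\<lambda>p q. 0\<^sub>m p q"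
  by simp

lift_definition plus_matalg :: "'a matalg \<Rightarrow> 'a matalg \<Rightarrow> 'a matalg"
  is "\<lambda>a b p q. a p q + b p q"
proof -
  fix a b :: "nat \<Rightarrow> nat \<Rightarrow> 'a mat"
  assume a: "(\<forall>p q. a p q \<in> carrier_mat p q) \<and> finite {(p, q). a p q \<noteq> 0\<^sub>m p q}"
    and b: "(\<forall>p q. b p q \<in> carrier_mat p q) \<and> finite {(p, q). b p q \<noteq> 0\<^sub>m p q}"
  have "{(p, q). a p q + b p q \<noteq> 0\<^sub>m p q}
      \<subseteq> {(p, q). a p q \<noteq> 0\<^sub>m p q} \<union> {(p, q). b p q \<noteq> 0\<^sub>m p q}"
    by auto
  then have "finite {(p, q). a p q + b p q \<noteq> 0\<^sub>m p q}"
    using a b by (meson finite_UnI finite_subset)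
  then show "(\<forall>p q. a p q + b p q \<in> carrier_mat p q) \<and> finite {(p, q). a p q + b p q \<noteq> 0\<^sub>m p q}"
    using a b by (simp add: add_carrier_mat)
qed

lift_definition uminus_matalg :: "'a matalg \<Rightarrow> 'a matalg" is "\<lambda>a p q. - a p q"
proof -
  fix a :: "nat \<Rightarrow> nat \<Rightarrow> 'a mat"
  assume a: "(\<forall>p q. a p q \<in> carrier_mat p q) \<and> finite {(p, q). a p q \<noteq> 0\<^sub>m p q}"
  have "- 0\<^sub>m p q = (0\<^sub>m p q :: 'a mat)" for p q
    by (rule eq_matI) auto
  then have "{(p, q). - a p q \<noteq> 0\<^sub>m p q} \<subseteq> {(p, q). a p q \<noteq> 0\<^sub>m p q}"
    by auto
  then show "(\<forall>p q. - a p q \<in> carrier_mat p q) \<and> finite {(p, q). - a p q \<noteq> 0\<^sub>m p q}"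
    using a by (auto intro: finite_subset)
qed

definition minus_matalg :: "'a matalg \<Rightarrow> 'a matalg \<Rightarrow> 'a matalg" where
  "minus_matalg a b = a + - b"

lemma block_add [simp]:
  "i < p \<Longrightarrow> j < q \<Longrightarrow> block (a + b) p q $$ (i, j) = block a p q $$ (i, j) + block b p q $$ (i, j)"
  by (simp add: plus_matalg.rep_eq)

lemma block_zero [simp]: "block 0 p q = 0\<^sub>m p q"
  by (simp add: zero_matalg.rep_eq)

lemma block_uminus [simp]:
  "i < p \<Longrightarrow> j < q \<Longrightarrow> block (- a) p q $$ (i, j) = - block a p q $$ (i, j)"
  by (simp add: uminus_matalg.rep_eq)

instance
  by standard (auto intro!: matalg_eqI simp: minus_matalg_def algebra_simps)

end

instantiation matalg :: (ring) ring
begin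

definition times_matalg :: "'a matalg \<Rightarrow> 'a matalg \<Rightarrow> 'a matalg" where
  "a * b = Abs_matalg (\<lambda>p r. mat p r (\<lambda>(i, k).
     \<Sum>q | block a p q \<noteq> 0\<^sub>m p q. (block a p q * block b q r) $$ (i, k)))"

lemma block_times_mat:
  "block (a * b) = (\<lambda>p r. mat p r (\<lambda>(i, k).
     \<Sum>q | block a p q \<noteq> 0\<^sub>m p q. (block a p q * block b q r) $$ (i, k)))"
proof -
  obtain M where M: "\<And>p q. M \<le> p \<or> M \<le> q \<Longrightarrow> block a p q = 0\<^sub>m p q" using block_bound by blast
  obtain N where N: "\<And>p q. N \<le> p \<or> N \<le> q \<Longrightarrow> block b p q = 0\<^sub>m p q" using block_bound by blast
  show ?thesis
    unfolding times_matalg_def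
  proof (rule Abs_block[where N = "max M N"])
    fix p r assume "max M N \<le> p \<or> max M N \<le> r"
    then have "M \<le> p \<or> N \<le> r" by auto
    then have "(block a p q * block b q r) $$ (i, k) = 0" if "i < p" "k < r" for i k q
      using M[of p q] N[of q r] that by (auto simp: scalar_prod_def)
    then show "mat p r (\<lambda>(i, k). \<Sum>q | block a p q \<noteq> 0\<^sub>m p q. (block a p q * block b q r) $$ (i, k))
        = 0\<^sub>m p r"
      by (intro eq_matI) auto
  qed auto
qed

lemma block_times:
  assumes ik: "i < p" "k < r"
    and N: "\<And>q. N \<le> q \<Longrightarrow> block a p q = 0\<^sub>m p q \<or> block b q r = 0\<^sub>m q r"
  shows "block (a * b) p r $$ (i, k)
    = (\<Sum>(q, j)\<in>(SIGMA q:{..<N}. {..<q}). block a p q $$ (i, j) * block b q r $$ (j, k))"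
proof -
  let ?S = "{q. block a p q \<noteq> 0\<^sub>m p q}"
  let ?f = "\<lambda>q. (block a p q * block b q r) $$ (i, k)"
  have fin: "finite ?S"
  proof (rule finite_subset)
    show "?S \<subseteq> snd ` {(p, q). block a p q \<noteq> 0\<^sub>m p q}" by force
  qed (use finite_block in blast)
  have entry: "?f q = (\<Sum>j<q. block a p q $$ (i, j) * block b q r $$ (j, k))" for q
    using ik by (simp add: scalar_prod_def lessThan_atLeast0)
  have "block (a * b) p r $$ (i, k) = sum ?f ?S"
    using ik by (simp add: block_times_mat)
  also have "\<dots> = sum ?f (?S \<union> {..<N})"
    by (rule sum.mono_neutral_left) (use fin ik in \<open>auto simp: scalar_prod_def\<close>)
  also have "\<dots> = sum ?f {..<N}"
  proof (rule sum.mono_neutral_right)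
    show "\<forall>q\<in>?S \<union> {..<N} - {..<N}. ?f q = 0"
    proof
      fix q assume q: "q \<in> ?S \<union> {..<N} - {..<N}"
      then have "block b q r = 0\<^sub>m q r" using N[of q] by auto
      then show "?f q = 0" using ik by (simp add: scalar_prod_def)
    qed
  qed (use fin in auto)
  also have "\<dots> = (\<Sum>(q, j)\<in>(SIGMA q:{..<N}. {..<q}). block a p q $$ (i, j) * block b q r $$ (j, k))"
    by (simp add: entry sum.Sigma)
  finally show ?thesis .
qed

instance
proof
  fix a b c :: "'a matalg"
  obtain Na where Na: "\<And>p q. Na \<le> p \<or> Na \<le> q \<Longrightarrow> block a p q = 0\<^sub>m p q" using block_bound by blast
  obtain Nb where Nb: "\<And>p q. Nb \<le> p \<or> Nb \<le> q \<Longrightarrow> block b p q = 0\<^sub>m p q" using block_bound by blast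
  obtain Nc where Nc: "\<And>p q. Nc \<le> p \<or> Nc \<le> q \<Longrightarrow> block c p q = 0\<^sub>m p q" using block_bound by blast
  let ?K = "\<lambda>N. SIGMA q:{..<N}. {..<q::nat}"
  show "a * b * c = a * (b * c)"
  proof (rule matalg_eqI)
    fix p s i l :: nat
    assume il: "i < p" "l < s"
    let ?A = "\<lambda>x. block a p (fst x) $$ (i, snd x)"
    let ?B = "\<lambda>x y. block b (fst x) (fst y) $$ (snd x, snd y)"
    let ?C = "\<lambda>y. block c (fst y) s $$ (snd y, l)"
    have "block (a * b * c) p s $$ (i, l) = (\<Sum>y\<in>?K Nc. block (a * b) p (fst y) $$ (i, snd y) * ?C y)"
      using il Nc by (subst block_times[where N = Nc]) (auto simp: case_prod_beta)
    also have "\<dots> = (\<Sum>y\<in>?K Nc. (\<Sum>x\<in>?K Na. ?A x * ?B x y) * ?C y)"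
      using il Na
      by (intro sum.cong refl arg_cong2[where f = times])
        (subst block_times[where N = Na], auto simp: case_prod_beta)
    also have "\<dots> = (\<Sum>x\<in>?K Na. ?A x * (\<Sum>y\<in>?K Nc. ?B x y * ?C y))"
      by (simp add: sum_distrib_left sum_distrib_right mult.assoc) (rule sum.swap)
    also have "\<dots> = (\<Sum>x\<in>?K Na. ?A x * block (b * c) (fst x) s $$ (snd x, l))"
      using il Nc
      by (intro sum.cong refl arg_cong2[where f = times])
        (subst block_times[where N = Nc], auto simp: case_prod_beta)
    also have "\<dots> = block (a * (b * c)) p s $$ (i, l)"
      using il Na by (subst block_times[where N = Na]) (auto simp: case_prod_beta)
    finally show "block (a * b * c) p s $$ (i, l) = block (a * (b * c)) p s $$ (i, l)" .
  qed
  show "(a + b) * c = a * c + b * c"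
  proof (rule matalg_eqI)
    fix p s i l :: nat
    assume il: "i < p" "l < s"
    have "block (a' * c) p s $$ (i, l) = (\<Sum>x\<in>?K Nc. block a' p (fst x) $$ (i, snd x)
        * block c (fst x) s $$ (snd x, l))" for a'
      using il Nc by (subst block_times[where N = Nc]) (auto simp: case_prod_beta)
    then show "block ((a + b) * c) p s $$ (i, l) = block (a * c + b * c) p s $$ (i, l)"
      using il by (simp add: sum.distrib[symmetric]) (rule sum.cong, auto simp: algebra_simps)
  qed
  show "a * (b + c) = a * b + a * c"
  proof (rule matalg_eqI)
    fix p s i l :: nat
    assume il: "i < p" "l < s"
    have "block (a * b') p s $$ (i, l) = (\<Sum>x\<in>?K Na. block a p (fst x) $$ (i, snd x)
        * block b' (fst x) s $$ (snd x, l))" for b'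
      using il Na by (subst block_times[where N = Na]) (auto simp: case_prod_beta)
    then show "block (a * (b + c)) p s $$ (i, l) = block (a * b + a * c) p s $$ (i, l)"
      using il by (simp add: sum.distrib[symmetric]) (rule sum.cong, auto simp: algebra_simps)
  qed
qed

end

text \<open>The inclusion of the single matrices; \<^term>\<open>Mat p q\<close> is Mat(p,q,B) as a subset of the algebra.\<close>

definition of_mat :: "'b::zero mat \<Rightarrow> 'b matalg" where
  "of_mat M = Abs_matalg (\<lambda>p q. if p = dim_row M \<and> q = dim_col M then M else 0\<^sub>m p q)"

definition Mat :: "nat \<Rightarrow> nat \<Rightarrow> 'b::zero matalg set" where
  "Mat p q = of_mat ` carrier_mat p q"

definition id_mat :: "nat \<Rightarrow> 'b::{zero,one} matalg" where
  "id_mat n = of_mat (1\<^sub>m n)"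

lemma block_of_mat:
  "block (of_mat M) = (\<lambda>p q. if p = dim_row M \<and> q = dim_col M then M else 0\<^sub>m p q)"
  unfolding of_mat_def
  by (rule Abs_block[where N = "Suc (max (dim_row M) (dim_col M))"]) auto

lemma of_mat_eq_iff:
  assumes "M \<in> carrier_mat p q" "N \<in> carrier_mat p q"
  shows "of_mat M = of_mat N \<longleftrightarrow> M = N"
proof
  assume "of_mat M = of_mat N"
  then have "block (of_mat M) p q = block (of_mat N) p q" by simp
  then show "M = N" using assms by (simp add: block_of_mat)
qed simp

lemma of_mat_add:
  assumes "M \<in> carrier_mat p q" "N \<in> carrier_mat p q"
  shows "of_mat (M + N) = of_mat M + of_mat N"
  using assms by (intro matalg_eqI) (auto simp: block_of_mat)

lemma of_mat_mult:
  "of_mat M * of_mat N = (if dim_col M = dim_row N then of_mat (M * N) else 0)"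
proof (rule matalg_eqI)
  fix p r i k :: nat
  assume ik: "i < p" "k < r"
  let ?S = "{q. block (of_mat M) p q \<noteq> 0\<^sub>m p q}"
  let ?f = "\<lambda>q. (block (of_mat M) p q * block (of_mat N) q r) $$ (i, k)"
  have S: "?S \<subseteq> {dim_col M}" by (auto simp: block_of_mat)
  have "block (of_mat M * of_mat N) p r $$ (i, k) = sum ?f ?S"
    using ik by (simp add: block_times_mat)
  also have "\<dots> = sum ?f {dim_col M}"
    by (rule sum.mono_neutral_left) (use S ik in \<open>auto simp: scalar_prod_def\<close>)
  also have "\<dots> = block (if dim_col M = dim_row N then of_mat (M * N) else 0) p r $$ (i, k)"
    using ik by (auto simp: block_of_mat scalar_prod_def)
  finally show "block (of_mat M * of_mat N) p r $$ (i, k)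
    = block (if dim_col M = dim_row N then of_mat (M * N) else 0) p r $$ (i, k)" .
qed

definition invertible_in :: "nat \<Rightarrow> 'b::ring_1 matalg \<Rightarrow> bool" where
  "invertible_in n a \<longleftrightarrow> a \<in> Mat n n \<and> (\<exists>b\<in>Mat n n. a * b = id_mat n \<and> b * a = id_mat n)"

definition inverse_in :: "nat \<Rightarrow> 'b::ring_1 matalg \<Rightarrow> 'b matalg" where
  "inverse_in n a = (THE b. b \<in> Mat n n \<and> a * b = id_mat n \<and> b * a = id_mat n)"

lemma id_mat_mult: "a \<in> Mat p q \<Longrightarrow> id_mat p * a = a" "a \<in> Mat p q \<Longrightarrow> a * id_mat q = a"
  for a :: "'b::ring_1 matalg"
  by (auto simp: Mat_def id_mat_def of_mat_mult)

lemma inverse_in: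
  assumes "invertible_in n a"
  shows "inverse_in n a \<in> Mat n n \<and> a * inverse_in n a = id_mat n \<and> inverse_in n a * a = id_mat n"
proof -
  obtain b where b: "b \<in> Mat n n" "a * b = id_mat n" "b * a = id_mat n"
    using assms unfolding invertible_in_def by blast
  show ?thesis
    unfolding inverse_in_def
  proof (rule theI[of _ b])
    fix c assume c: "c \<in> Mat n n \<and> a * c = id_mat n \<and> c * a = id_mat n"
    have "c = b * a * c" using b c id_mat_mult(1)[of c n n] by metis
    also have "\<dots> = b" using b c id_mat_mult(2)[of b n n] by (metis mult.assoc)
    finally show "c = b" .
  qed (use b in blast)
qed


section \<open>Algebras, bimodules and derivations\<close>

text \<open>Algebras need not be unital here: the matrix algebra above has no unit.\<close>

locale assoc_algebra = Modules.module scale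
  for scale :: "'k::comm_ring_1 \<Rightarrow> 'a::ring \<Rightarrow> 'a" +
  assumes scale_mult_left: "scale c (x * y) = scale c x * y"
    and scale_mult_right: "scale c (x * y) = x * scale c y"

locale algebra_bimodule = alg: assoc_algebra scaleA + Modules.module scaleW
  for scaleA :: "'k::comm_ring_1 \<Rightarrow> 'a::ring \<Rightarrow> 'a"
    and scaleW :: "'k \<Rightarrow> 'w::ab_group_add \<Rightarrow> 'w" +
  fixes lact :: "'a \<Rightarrow> 'w \<Rightarrow> 'w" (infixr \<open>\<cdot>\<^sub>l\<close> 70)
    and ract :: "'w \<Rightarrow> 'a \<Rightarrow> 'w" (infixl \<open>\<cdot>\<^sub>r\<close> 70)
  assumes lact_add_left: "(a + b) \<cdot>\<^sub>l w = (a \<cdot>\<^sub>l w) + (b \<cdot>\<^sub>l w)"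
    and lact_add_right: "a \<cdot>\<^sub>l (v + w) = (a \<cdot>\<^sub>l v) + (a \<cdot>\<^sub>l w)"
    and ract_add_left: "(v + w) \<cdot>\<^sub>r a = (v \<cdot>\<^sub>r a) + (w \<cdot>\<^sub>r a)"
    and ract_add_right: "w \<cdot>\<^sub>r (a + b) = (w \<cdot>\<^sub>r a) + (w \<cdot>\<^sub>r b)"
    and lact_scale_left: "scaleA c a \<cdot>\<^sub>l w = scaleW c (a \<cdot>\<^sub>l w)"
    and lact_scale_right: "a \<cdot>\<^sub>l scaleW c w = scaleW c (a \<cdot>\<^sub>l w)"
    and ract_scale_left: "scaleW c w \<cdot>\<^sub>r a = scaleW c (w \<cdot>\<^sub>r a)"
    and ract_scale_right: "w \<cdot>\<^sub>r scaleA c a = scaleW c (w \<cdot>\<^sub>r a)"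
    and lact_mult: "(a * b) \<cdot>\<^sub>l w = a \<cdot>\<^sub>l (b \<cdot>\<^sub>l w)"
    and ract_mult: "w \<cdot>\<^sub>r (a * b) = (w \<cdot>\<^sub>r a) \<cdot>\<^sub>r b"
    and lact_ract: "(a \<cdot>\<^sub>l w) \<cdot>\<^sub>r b = a \<cdot>\<^sub>l (w \<cdot>\<^sub>r b)"

locale derivation = algebra_bimodule scaleA scaleW lact ract + Modules.module_hom scaleA scaleW D
  for scaleA :: "'k::comm_ring_1 \<Rightarrow> 'a::ring \<Rightarrow> 'a"
    and scaleW :: "'k \<Rightarrow> 'w::ab_group_add \<Rightarrow> 'w"
    and lact :: "'a \<Rightarrow> 'w \<Rightarrow> 'w" (infixr \<open>\<cdot>\<^sub>l\<close> 70)
    and ract :: "'w \<Rightarrow> 'a \<Rightarrow> 'w" (infixl \<open>\<cdot>\<^sub>r\<close> 70)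
    and D :: "'a \<Rightarrow> 'w" +
  assumes Leibniz: "D (a * b) = (D a \<cdot>\<^sub>r b) + (a \<cdot>\<^sub>l D b)"

text \<open>The scalars act entrywise on matrices, via their action on B.\<close>

definition scale_matalg :: "('k \<Rightarrow> 'b::zero \<Rightarrow> 'b) \<Rightarrow> 'k \<Rightarrow> 'b matalg \<Rightarrow> 'b matalg" where
  "scale_matalg scale c a = Abs_matalg (\<lambda>p q. map_mat (scale c) (block a p q))"

lemma (in assoc_algebra) assoc_algebra_matalg: "assoc_algebra (scale_matalg scale)"
proof -
  have blk [simp]: "block (scale_matalg scale c a) = (\<lambda>p q. map_mat (scale c) (block a p q))" for c a
  proof -
    obtain N where N: "\<And>p q. N \<le> p \<or> N \<le> q \<Longrightarrow> block a p q = 0\<^sub>m p q"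
      using block_bound by blast
    show ?thesis
      unfolding scale_matalg_def
    proof (rule Abs_block[where N = N])
      fix p q assume "N \<le> p \<or> N \<le> q"
      then show "map_mat (scale c) (block a p q) = 0\<^sub>m p q"
        by (intro eq_matI) (simp_all add: N)
    qed simp
  qed
  show ?thesis
  proof (intro assoc_algebra.intro Modules.module.intro assoc_algebra_axioms.intro, goal_cases)
    case (5 c x y)
    obtain N where N: "\<And>p q. N \<le> p \<or> N \<le> q \<Longrightarrow> block y p q = 0\<^sub>m p q" using block_bound by blast
    show ?case
    proof (rule matalg_eqI)
      fix p r i k :: nat
      assume ik: "i < p" "k < r"
      have *: "block (z * y) p r $$ (i, k) = (\<Sum>(q, j)\<in>(SIGMA q:{..<N}. {..<q}).
          block z p q $$ (i, j) * block y q r $$ (j, k))" for z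
        using ik N by (intro block_times) auto
      show "block (scale_matalg scale c (x * y)) p r $$ (i, k)
          = block (scale_matalg scale c x * y) p r $$ (i, k)"
        unfolding * using ik
        by (simp add: blk * scale_sum_right case_prod_beta)
          (rule sum.cong, auto simp: scale_mult_left)
    qed
  next
    case (6 c x y)
    obtain N where N: "\<And>p q. N \<le> p \<or> N \<le> q \<Longrightarrow> block x p q = 0\<^sub>m p q" using block_bound by blast
    show ?case
    proof (rule matalg_eqI)
      fix p r i k :: nat
      assume ik: "i < p" "k < r"
      have *: "block (x * z) p r $$ (i, k) = (\<Sum>(q, j)\<in>(SIGMA q:{..<N}. {..<q}).
          block x p q $$ (i, j) * block z q r $$ (j, k))" for z
        using ik N by (intro block_times) auto
      show "block (scale_matalg scale c (x * y)) p r $$ (i, k)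
          = block (x * scale_matalg scale c y) p r $$ (i, k)"
        unfolding * using ik
        by (simp add: blk * scale_sum_right case_prod_beta)
          (rule sum.cong, auto simp: scale_mult_right)
    qed
  qed (auto intro!: matalg_eqI simp: scale_right_distrib scale_left_distrib)
qed

definition has_size ::
  "('b::ring_1 matalg \<Rightarrow> 'w \<Rightarrow> 'w) \<Rightarrow> ('w \<Rightarrow> 'b matalg \<Rightarrow> 'w) \<Rightarrow> nat \<Rightarrow> nat \<Rightarrow> 'w \<Rightarrow> bool" where
  "has_size lact ract p q w \<longleftrightarrow> ract (lact (id_mat p) w) (id_mat q) = w"

definition size_preserving ::
  "('b::ring_1 matalg \<Rightarrow> 'w \<Rightarrow> 'w) \<Rightarrow> ('w \<Rightarrow> 'b matalg \<Rightarrow> 'w) \<Rightarrow> ('b matalg \<Rightarrow> 'w) \<Rightarrow> bool" where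
  "size_preserving lact ract D \<longleftrightarrow> (\<forall>p q. \<forall>a\<in>Mat p q. has_size lact ract p q (D a))"

end

theory Submission
  imports Defs
begin

text \<open>
  Put \<open>G = I + U\<^sub>0 (Q X)\<^sup>-\<^sup>1 V\<^sub>0\<close>. By the Sylvester equation \<open>X P - Q X = V\<^sub>0 U\<^sub>0\<close>, the inverse of \<open>G\<close> is
  \<open>I - U\<^sub>0 (X P)\<^sup>-\<^sup>1 V\<^sub>0\<close>. By the Leibniz rule the claim reduces to
  \<open>db G + G d\<phi>\<^sub>0 = d\<phi> G\<close>; the two constraints on \<open>U\<^sub>0\<close> and \<open>V\<^sub>0\<close> move \<open>d\<phi>\<^sub>0\<close> inside, where
  it becomes \<open>- \<alpha>\<close> and \<open>\<beta>\<close>. What remains is \<open>U\<^sub>0 (...) V\<^sub>0\<close>, where the bracket vanishes: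
  multiplied by \<open>X\<close> on the left and by \<open>Q X\<close> on the right, it is a combination of the equations
  for \<open>Q\<close> and \<open>X\<close>.
\<close>

section \<open>Matrices of a fixed size and inverses in the square blocks\<close>

lemma Mat_mult: "a \<in> Mat p q \<Longrightarrow> b \<in> Mat q r \<Longrightarrow> a * b \<in> Mat p r"
  for a b :: "'b::ring matalg"
  by (auto simp: Mat_def of_mat_mult)

lemma Mat_add: "a \<in> Mat p q \<Longrightarrow> b \<in> Mat p q \<Longrightarrow> a + b \<in> Mat p q"
  for a b :: "'b::ab_group_add matalg"
  unfolding Mat_def by (auto simp: of_mat_add[symmetric])

lemma Mat_uminus: "a \<in> Mat p q \<Longrightarrow> - a \<in> Mat p q"
  for a :: "'b::ab_group_add matalg"
proof -
  assume "a \<in> Mat p q"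
  then obtain M where M: "M \<in> carrier_mat p q" "a = of_mat M" by (auto simp: Mat_def)
  have "- a = of_mat (- M)"
    using M by (intro matalg_eqI) (auto simp: block_of_mat)
  then show ?thesis using M by (auto simp: Mat_def)
qed

lemma Mat_diff: "a \<in> Mat p q \<Longrightarrow> b \<in> Mat p q \<Longrightarrow> a - b \<in> Mat p q"
  for a b :: "'b::ab_group_add matalg"
  using Mat_add[of a p q "- b"] Mat_uminus[of b p q] by simp

lemma id_mat_Mat: "id_mat n \<in> Mat n n"
  by (auto simp: Mat_def id_mat_def)

lemma invertible_inI:
  assumes "a \<in> Mat n n" "b \<in> Mat n n" "a * b = id_mat n" "b * a = id_mat n"
  shows "invertible_in n a"
  using assms unfolding invertible_in_def by blast

lemma inverse_in_eqI:
  fixes a b :: "'b::ring_1 matalg"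
  assumes "a \<in> Mat n n" "b \<in> Mat n n" "a * b = id_mat n" "b * a = id_mat n"
  shows "inverse_in n a = b"
proof -
  note i = inverse_in[OF invertible_inI[OF assms]]
  have "inverse_in n a = b * a * inverse_in n a"
    using i assms id_mat_mult(1)[of _ n n] by metis
  also have "\<dots> = b"
    using i assms id_mat_mult(2)[of _ n n] by (metis mult.assoc)
  finally show ?thesis .
qed

text \<open>The inner factor \<open>b * b'\<close> collapses first. Used in both orders, this yields
  the two halves of "\<open>b' * a'\<close> inverts \<open>a * b\<close>".\<close>

lemma mult_eq_id_mat:
  fixes a b a' b' :: "'b::ring_1 matalg"
  assumes "a \<in> Mat n n" "a' \<in> Mat n n" "a * a' = id_mat n" "b * b' = id_mat n"
  shows "a * b * (b' * a') = id_mat n"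
proof -
  have "a * b * (b' * a') = a * (b * b') * a'" by (simp add: mult.assoc)
  then show ?thesis using assms by (simp add: id_mat_mult)
qed

lemma inverse_in_mult:
  fixes a b :: "'b::ring_1 matalg"
  assumes "invertible_in n a" "invertible_in n b"
  shows "invertible_in n (a * b)" "inverse_in n (a * b) = inverse_in n b * inverse_in n a"
proof -
  let ?a = "inverse_in n a" and ?b = "inverse_in n b"
  have ab: "a \<in> Mat n n" "b \<in> Mat n n" using assms by (auto simp: invertible_in_def)
  note ia = inverse_in[OF assms(1)] and ib = inverse_in[OF assms(2)]
  have "a * b * (?b * ?a) = id_mat n" "?b * ?a * (a * b) = id_mat n"
    using ab ia ib by (auto intro: mult_eq_id_mat)
  with ab ia ib show "invertible_in n (a * b)" "inverse_in n (a * b) = ?b * ?a"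
    by (auto intro!: inverse_in_eqI invertible_inI[where b = "?b * ?a"] Mat_mult)
qed

section \<open>Bimodule arithmetic, derivatives of inverses, sizes of forms\<close>

context algebra_bimodule
begin

lemma lact_zero [simp]: "0 \<cdot>\<^sub>l w = 0" "a \<cdot>\<^sub>l 0 = 0"
  using lact_add_left[of 0 0 w] lact_add_right[of a 0 0] by simp_all

lemma ract_zero [simp]: "w \<cdot>\<^sub>r 0 = 0" "0 \<cdot>\<^sub>r a = 0"
  using ract_add_right[of w 0 0] ract_add_left[of 0 0 a] by simp_all

lemma lact_minus: "(- a) \<cdot>\<^sub>l w = - (a \<cdot>\<^sub>l w)" "a \<cdot>\<^sub>l (- w) = - (a \<cdot>\<^sub>l w)"
  using lact_add_left[of "- a" a w] lact_add_right[of a "- w" w]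
  by (simp_all add: eq_neg_iff_add_eq_0)

lemma ract_minus: "w \<cdot>\<^sub>r (- a) = - (w \<cdot>\<^sub>r a)" "(- w) \<cdot>\<^sub>r a = - (w \<cdot>\<^sub>r a)"
  using ract_add_right[of w "- a" a] ract_add_left[of "- w" w a]
  by (simp_all add: eq_neg_iff_add_eq_0)

lemma lact_diff: "(a - b) \<cdot>\<^sub>l w = (a \<cdot>\<^sub>l w) - (b \<cdot>\<^sub>l w)" "a \<cdot>\<^sub>l (v - w) = (a \<cdot>\<^sub>l v) - (a \<cdot>\<^sub>l w)"
  using lact_add_left[of a "- b" w] lact_add_right[of a v "- w"] by (simp_all add: lact_minus)

lemma ract_diff: "w \<cdot>\<^sub>r (a - b) = (w \<cdot>\<^sub>r a) - (w \<cdot>\<^sub>r b)" "(v - w) \<cdot>\<^sub>r a = (v \<cdot>\<^sub>r a) - (w \<cdot>\<^sub>r a)"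
  using ract_add_right[of w a "- b"] ract_add_left[of v "- w" a] by (simp_all add: ract_minus)

lemmas bimodule_simps = lact_add_left lact_add_right ract_add_left ract_add_right
  lact_minus ract_minus lact_diff ract_diff lact_mult ract_mult lact_ract

end

text \<open>Differentiate \<open>x * y = e\<close> and multiply by \<open>y\<close> on the left. The
  element \<open>e\<close> stands for an identity matrix; since the algebra has no unit, its
  constancy and its trivial action on \<open>D y\<close> are hypotheses.\<close>

lemma (in derivation) derivation_inverse:
  assumes "x * y = e" "y * x = e" "D e = 0" "e \<cdot>\<^sub>l D y = D y"
  shows "D y = - (y \<cdot>\<^sub>l (D x \<cdot>\<^sub>r y))"
proof -
  have "(D x \<cdot>\<^sub>r y) + (x \<cdot>\<^sub>l D y) = 0"
    using Leibniz[of x y] assms by simp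
  then have "y \<cdot>\<^sub>l ((D x \<cdot>\<^sub>r y) + (x \<cdot>\<^sub>l D y)) = 0"
    by simp
  then have "(y \<cdot>\<^sub>l (D x \<cdot>\<^sub>r y)) + D y = 0"
    using assms by (simp add: lact_add_right lact_mult[symmetric])
  then show ?thesis
    by (simp add: eq_neg_iff_add_eq_0 add.commute)
qed

text \<open>Identity matrices are idempotent, so multiplying the two-sided size condition once more
  by one of them gives the one-sided conditions.\<close>

lemma has_size_id:
  fixes lact :: "'b::ring_1 matalg \<Rightarrow> 'w::ab_group_add \<Rightarrow> 'w" and ract :: "'w \<Rightarrow> 'b matalg \<Rightarrow> 'w"
    and s :: "'k::comm_ring_1 \<Rightarrow> 'b matalg \<Rightarrow> 'b matalg"
  assumes "algebra_bimodule s scaleW lact ract" and w: "has_size lact ract p q w"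
  shows "lact (id_mat p) w = w" "ract w (id_mat q) = w"
proof -
  interpret B: algebra_bimodule s scaleW lact ract by fact
  have i: "id_mat r * id_mat r = (id_mat r :: 'b matalg)" for r
    by (rule id_mat_mult) (rule id_mat_Mat)
  show "lact (id_mat p) w = w"
    by (metis w has_size_def i B.lact_mult B.lact_ract)
  show "ract w (id_mat q) = w"
    by (metis w has_size_def i B.ract_mult)
qed

section \<open>The algebraic core: cancellation between the linear equations, and invertibility of
  the dressing factor\<close>

text \<open>
  Here \<open>dX\<close>, \<open>dQ\<close>, \<open>bX\<close>, \<open>bQ\<close> stand for the images of \<open>X\<close> and \<open>Q\<close> under \<open>d\<close> and \<open>db\<close>, and \<open>W\<close>, \<open>Y\<close>
  for the inverses of \<open>X\<close> and \<open>Q\<close>, so that \<open>- (W \<cdot>\<^sub>l dX \<cdot>\<^sub>r W)\<close> is \<open>d X\<^sup>-\<^sup>1\<close>.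
\<close>

lemma (in algebra_bimodule) dressing_identity:
  assumes inv: "X * W = e" "W * X = e" "Q * Y = e" "Y * Q = e"
    and e: "W * e = W" "e * Y = Y"
    and size: "e \<cdot>\<^sub>l \<alpha> = \<alpha>" "e \<cdot>\<^sub>l \<beta> = \<beta>" "\<beta> \<cdot>\<^sub>r e = \<beta>" "e \<cdot>\<^sub>l dQ = dQ" "dQ \<cdot>\<^sub>r e = dQ" "dX \<cdot>\<^sub>r e = dX"
    and Q: "bQ - (Q \<cdot>\<^sub>l dQ) = (\<beta> \<cdot>\<^sub>r Q) - (Q \<cdot>\<^sub>l \<beta>)"
    and X: "bX - (dX \<cdot>\<^sub>r P) + (dQ \<cdot>\<^sub>r X) = (X \<cdot>\<^sub>l \<alpha>) + (\<beta> \<cdot>\<^sub>r X)"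
  shows "- (W \<cdot>\<^sub>l (bX \<cdot>\<^sub>r (W * Y))) - ((W * Y) \<cdot>\<^sub>l (bQ \<cdot>\<^sub>r Y)) + ((W * Y) \<cdot>\<^sub>l \<beta>)
    = - (\<alpha> \<cdot>\<^sub>r (W * Y)) - (W \<cdot>\<^sub>l (dX \<cdot>\<^sub>r W)) - (W \<cdot>\<^sub>l (dX \<cdot>\<^sub>r (W * (X * P - Q * X) * W * Y)))"
proof -
  \<comment> \<open>The equations for \<open>Q\<close> and \<open>X\<close> are solved for
    \<open>bQ\<close> and \<open>bX\<close>, so that only \<open>dQ\<close>, \<open>dX\<close>,
    \<open>\<alpha>\<close> and \<open>\<beta>\<close> remain. The terms in \<open>dQ\<close> and in
    \<open>W \<cdot>\<^sub>l (\<beta> \<cdot>\<^sub>r Y)\<close> from \<open>1\<close> and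
    \<open>2\<close> cancel in the end.\<close>
  have bQ: "bQ = (Q \<cdot>\<^sub>l dQ) + (\<beta> \<cdot>\<^sub>r Q) - (Q \<cdot>\<^sub>l \<beta>)"
    using Q by (simp add: algebra_simps)
  have "(W * Y) \<cdot>\<^sub>l (bQ \<cdot>\<^sub>r Y) = (W \<cdot>\<^sub>l (Y * Q) \<cdot>\<^sub>l (dQ \<cdot>\<^sub>r Y)) + (W \<cdot>\<^sub>l Y \<cdot>\<^sub>l (\<beta> \<cdot>\<^sub>r (Q * Y)))
      - (W \<cdot>\<^sub>l (Y * Q) \<cdot>\<^sub>l (\<beta> \<cdot>\<^sub>r Y))"
    unfolding bQ by (simp add: bimodule_simps)
  then have 1: "(W * Y) \<cdot>\<^sub>l (bQ \<cdot>\<^sub>r Y) = (W \<cdot>\<^sub>l (dQ \<cdot>\<^sub>r Y)) + (W \<cdot>\<^sub>l Y \<cdot>\<^sub>l \<beta>) - (W \<cdot>\<^sub>l (\<beta> \<cdot>\<^sub>r Y))"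
    unfolding inv by (simp add: size lact_ract[symmetric])
  have bX: "bX = (dX \<cdot>\<^sub>r P) - (dQ \<cdot>\<^sub>r X) + (X \<cdot>\<^sub>l \<alpha>) + (\<beta> \<cdot>\<^sub>r X)"
    using X by (simp add: algebra_simps)
  have "W \<cdot>\<^sub>l (bX \<cdot>\<^sub>r (W * Y)) = (W \<cdot>\<^sub>l (dX \<cdot>\<^sub>r (P * W * Y))) - (W \<cdot>\<^sub>l (dQ \<cdot>\<^sub>r (X * W) \<cdot>\<^sub>r Y))
      + ((W * X) \<cdot>\<^sub>l (\<alpha> \<cdot>\<^sub>r (W * Y))) + (W \<cdot>\<^sub>l (\<beta> \<cdot>\<^sub>r (X * W) \<cdot>\<^sub>r Y))"
    unfolding bX by (simp add: bimodule_simps)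
  then have 2: "W \<cdot>\<^sub>l (bX \<cdot>\<^sub>r (W * Y)) = (W \<cdot>\<^sub>l (dX \<cdot>\<^sub>r (P * W * Y))) - (W \<cdot>\<^sub>l (dQ \<cdot>\<^sub>r Y))
      + (\<alpha> \<cdot>\<^sub>r (W * Y)) + (W \<cdot>\<^sub>l (\<beta> \<cdot>\<^sub>r Y))"
    unfolding inv by (simp add: size lact_ract[symmetric])
  \<comment> \<open>The factor \<open>e\<close> stays in front of \<open>P\<close> here, as
    \<open>P\<close> carries no size in this lemma; it is absorbed later by
    \<open>dX \<cdot>\<^sub>r e = dX\<close>.\<close>
  have "W * (X * P - Q * X) * W * Y = (W * X) * P * W * Y - W * Q * ((X * W) * Y)"
    by (simp add: algebra_simps)
  also have "\<dots> = e * (P * W * Y) - W * (Q * Y)"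
    unfolding inv by (simp add: inv e mult.assoc)
  finally have "W * (X * P - Q * X) * W * Y = e * (P * W * Y) - W"
    by (simp add: inv e)
  then have 3: "W \<cdot>\<^sub>l (dX \<cdot>\<^sub>r (W * (X * P - Q * X) * W * Y))
      = (W \<cdot>\<^sub>l ((dX \<cdot>\<^sub>r e) \<cdot>\<^sub>r (P * W * Y))) - (W \<cdot>\<^sub>l (dX \<cdot>\<^sub>r W))"
    by (simp add: bimodule_simps)
  show ?thesis unfolding 1 2 3 by (simp add: size algebra_simps lact_mult)
qed

text \<open>This is the Sherman-Morrison-Woodbury formula: by the Sylvester equation,
  \<open>X * P\<close> is the perturbation of \<open>Q * X\<close> by \<open>V * U\<close>.\<close>

lemma invertible_in_sylvester:
  fixes P Q X U V :: "'b::ring_1 matalg"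
  assumes P: "invertible_in n P" and Q: "invertible_in n Q" and X: "invertible_in n X"
    and U: "U \<in> Mat m n" and V: "V \<in> Mat n m" and S: "X * P - Q * X = V * U"
  shows "invertible_in m (id_mat m + U * inverse_in n (Q * X) * V)"
proof -
  define A B where "A = inverse_in n (Q * X)" and "B = inverse_in n (X * P)"
  have A: "A \<in> Mat n n" "A * (Q * X) = id_mat n" "(Q * X) * A = id_mat n"
    using inverse_in[OF inverse_in_mult(1)[OF Q X]] by (simp_all add: A_def)
  have B: "B \<in> Mat n n" "B * (X * P) = id_mat n" "(X * P) * B = id_mat n"
    using inverse_in[OF inverse_in_mult(1)[OF X P]] by (simp_all add: B_def)
  have M: "U * A * V \<in> Mat m m" "U * B * V \<in> Mat m m"
    using A B U V by (auto intro: Mat_mult)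
  \<comment> \<open>A resolvent identity: \<open>V * U\<close> is the difference of the elements
    inverted by \<open>B\<close> and \<open>A\<close>. Both orders are needed for a two-sided
    inverse.\<close>
  have "A * (V * U) * B = A * ((X * P) * B) - (A * (Q * X)) * B"
    unfolding S[symmetric] by (simp add: algebra_simps)
  then have AB: "A * (V * U) * B = A - B"
    using A B by (simp add: id_mat_mult)
  have "B * (V * U) * A = (B * (X * P)) * A - B * ((Q * X) * A)"
    unfolding S[symmetric] by (simp add: algebra_simps)
  then have BA: "B * (V * U) * A = A - B"
    using A B by (simp add: id_mat_mult)
  note i = id_mat_mult[OF id_mat_Mat] M[THEN id_mat_mult(1)] M[THEN id_mat_mult(2)]
  \<comment> \<open>The bracket between \<open>U\<close> and \<open>V\<close> vanishes by
    \<open>AB\<close>, and by \<open>BA\<close> for the opposite product.\<close>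
  have "(id_mat m + U * A * V) * (id_mat m - U * B * V)
      = id_mat m + U * (A - B - A * (V * U) * B) * V"
    by (simp only: distrib_left distrib_right left_diff_distrib right_diff_distrib i)
      (simp add: algebra_simps)
  moreover have "(id_mat m - U * B * V) * (id_mat m + U * A * V)
      = id_mat m + U * (A - B - B * (V * U) * A) * V"
    by (simp only: distrib_left distrib_right left_diff_distrib right_diff_distrib i)
      (simp add: algebra_simps)
  ultimately show ?thesis
    unfolding A_def[symmetric] AB BA
    by (intro invertible_inI[where b = "id_mat m - U * B * V"])
      (auto intro: Mat_add Mat_diff M id_mat_Mat)
qed

section \<open>The Miura equation for the dressed pair\<close>

theorem corollary3p5:
  fixes scaleB :: "'k::comm_ring_1 \<Rightarrow> 'b::ring_1 \<Rightarrow> 'b"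
    and scaleW :: "'k \<Rightarrow> 'w::ab_group_add \<Rightarrow> 'w"
    and lact :: "'b matalg \<Rightarrow> 'w \<Rightarrow> 'w" (infixr \<open>\<cdot>\<^sub>l\<close> 70)
    and ract :: "'w \<Rightarrow> 'b matalg \<Rightarrow> 'w" (infixl \<open>\<cdot>\<^sub>r\<close> 70)
    and d db :: "'b matalg \<Rightarrow> 'w"
    and m n :: nat
    and \<phi>\<^sub>0 g\<^sub>0 P Q U\<^sub>0 V\<^sub>0 X \<phi> g :: "'b matalg"
    and \<alpha> \<beta> :: 'w
  assumes "assoc_algebra scaleB"
    and "algebra_bimodule (scale_matalg scaleB) scaleW lact ract"
    and "derivation (scale_matalg scaleB) scaleW lact ract d"
    and "derivation (scale_matalg scaleB) scaleW lact ract db"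
    and "size_preserving lact ract d"
    and "size_preserving lact ract db"
    and "d (id_mat m) = 0" and "db (id_mat m) = 0"
    and "d (id_mat n) = 0" and "db (id_mat n) = 0"
    and "\<phi>\<^sub>0 \<in> Mat m m" and "g\<^sub>0 \<in> Mat m m" and "invertible_in m g\<^sub>0"
    and "db g\<^sub>0 \<cdot>\<^sub>r inverse_in m g\<^sub>0 = d \<phi>\<^sub>0"
    and "P \<in> Mat n n" and "invertible_in n P"
    and "Q \<in> Mat n n" and "invertible_in n Q"
    and "has_size lact ract n n \<alpha>" and "has_size lact ract n n \<beta>"
    and "db P - (d P \<cdot>\<^sub>r P) = - ((\<alpha> \<cdot>\<^sub>r P) - (P \<cdot>\<^sub>l \<alpha>))"
    and "db Q - (Q \<cdot>\<^sub>l d Q) = (\<beta> \<cdot>\<^sub>r Q) - (Q \<cdot>\<^sub>l \<beta>)"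
    and "U\<^sub>0 \<in> Mat m n" and "d U\<^sub>0 = 0" and "db U\<^sub>0 = 0"
    and "V\<^sub>0 \<in> Mat n m" and "d V\<^sub>0 = 0" and "db V\<^sub>0 = 0"
    and "X \<in> Mat n n" and "invertible_in n X"
    and "X * P - Q * X = V\<^sub>0 * U\<^sub>0"
    and "db X - (d X \<cdot>\<^sub>r P) + (d Q \<cdot>\<^sub>r X) = (X \<cdot>\<^sub>l \<alpha>) + (\<beta> \<cdot>\<^sub>r X)"
    and "(d \<phi>\<^sub>0 \<cdot>\<^sub>r U\<^sub>0) + (U\<^sub>0 \<cdot>\<^sub>l \<alpha>) = 0"
    and "(V\<^sub>0 \<cdot>\<^sub>l d \<phi>\<^sub>0) - (\<beta> \<cdot>\<^sub>r V\<^sub>0) = 0"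
    and "\<phi> = \<phi>\<^sub>0 + U\<^sub>0 * inverse_in n X * V\<^sub>0"
    and "g = (id_mat m + U\<^sub>0 * inverse_in n (Q * X) * V\<^sub>0) * g\<^sub>0"
  shows "invertible_in m g \<and> db g \<cdot>\<^sub>r inverse_in m g = d \<phi>"
proof -
  interpret d: derivation "scale_matalg scaleB" scaleW lact ract d by fact
  interpret db: derivation "scale_matalg scaleB" scaleW lact ract db by fact
  note bim = assms(2)
  note sizes = assms(11,15,17,23,26,29)
  define W Y where "W = inverse_in n X" and "Y = inverse_in n Q"
  define e where "e = (id_mat n :: 'b matalg)"
  have W: "W \<in> Mat n n" "X * W = e" "W * X = e"
    using inverse_in[OF assms(30)] by (simp_all add: W_def e_def)
  have Y: "Y \<in> Mat n n" "Q * Y = e" "Y * Q = e"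
    using inverse_in[OF assms(18)] by (simp_all add: Y_def e_def)
  have QX: "inverse_in n (Q * X) = W * Y"
    unfolding W_def Y_def by (rule inverse_in_mult(2)) fact+
  have d_id: "id_mat p \<cdot>\<^sub>l d a = d a" "d a \<cdot>\<^sub>r id_mat q = d a"
    and db_id: "id_mat p \<cdot>\<^sub>l db a = db a" "db a \<cdot>\<^sub>r id_mat q = db a" if "a \<in> Mat p q" for a p q
    using that assms(5,6) has_size_id[OF bim] unfolding size_preserving_def by blast+
  have \<alpha>: "e \<cdot>\<^sub>l \<alpha> = \<alpha>" and \<beta>: "e \<cdot>\<^sub>l \<beta> = \<beta>" "\<beta> \<cdot>\<^sub>r e = \<beta>"
    unfolding e_def using has_size_id[OF bim] assms(19,20) by blast+
  have dW: "d W = - (W \<cdot>\<^sub>l (d X \<cdot>\<^sub>r W))"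
    using W d_id[OF W(1)] assms(9) by (intro d.derivation_inverse) (auto simp: e_def)
  have bW: "db W = - (W \<cdot>\<^sub>l (db X \<cdot>\<^sub>r W))"
    using W db_id[OF W(1)] assms(10) by (intro db.derivation_inverse) (auto simp: e_def)
  have bY: "db Y = - (Y \<cdot>\<^sub>l (db Q \<cdot>\<^sub>r Y))"
    using Y db_id[OF Y(1)] assms(10) by (intro db.derivation_inverse) (auto simp: e_def)
  \<comment> \<open>The equation left between \<open>U\<^sub>0\<close> and \<open>V\<^sub>0\<close>
    once \<open>d \<phi>\<^sub>0\<close> has been traded for \<open>\<beta>\<close> and
    \<open>- \<alpha>\<close>: the dressing identity, read through the derivatives of
    \<open>W\<close> and \<open>Y\<close>.\<close>
  have key: "db (W * Y) + ((W * Y) \<cdot>\<^sub>l \<beta>) = d W - (\<alpha> \<cdot>\<^sub>r (W * Y)) + (d W \<cdot>\<^sub>r (V\<^sub>0 * U\<^sub>0 * W * Y))"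
  proof -
    have "- (W \<cdot>\<^sub>l (db X \<cdot>\<^sub>r (W * Y))) - ((W * Y) \<cdot>\<^sub>l (db Q \<cdot>\<^sub>r Y)) + ((W * Y) \<cdot>\<^sub>l \<beta>)
      = - (\<alpha> \<cdot>\<^sub>r (W * Y)) - (W \<cdot>\<^sub>l (d X \<cdot>\<^sub>r W)) - (W \<cdot>\<^sub>l (d X \<cdot>\<^sub>r (W * (X * P - Q * X) * W * Y)))"
      using W Y \<alpha> \<beta> assms(22,32) sizes
      by (intro d.dressing_identity[where e = e]) (auto simp: e_def id_mat_mult d_id)
    then show ?thesis
      unfolding assms(31) d.Leibniz db.Leibniz dW bW bY
      by (simp add: d.bimodule_simps mult.assoc)
  qed
  define G where "G = id_mat m + U\<^sub>0 * (W * Y) * V\<^sub>0"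
  have UW: "U\<^sub>0 * W * V\<^sub>0 \<in> Mat m m"
    using W sizes by (auto intro: Mat_mult)
  have invG: "invertible_in m G"
    using invertible_in_sylvester[OF assms(16,18,30,23,26,31)] by (simp add: G_def QX)
  have g: "g = G * g\<^sub>0"
    by (simp add: assms(36) G_def QX)
  have inv_g: "invertible_in m g"
    unfolding g by (rule inverse_in_mult(1)[OF invG assms(13)])
  have d\<phi>: "d \<phi> = d \<phi>\<^sub>0 + (U\<^sub>0 \<cdot>\<^sub>l (d W \<cdot>\<^sub>r V\<^sub>0))"
    unfolding assms(35) W_def[symmetric] by (simp add: d.add d.Leibniz assms d.bimodule_simps)
  have d\<phi>\<^sub>0U: "d \<phi>\<^sub>0 \<cdot>\<^sub>r U\<^sub>0 = - (U\<^sub>0 \<cdot>\<^sub>l \<alpha>)" and Vd\<phi>\<^sub>0: "V\<^sub>0 \<cdot>\<^sub>l d \<phi>\<^sub>0 = \<beta> \<cdot>\<^sub>r V\<^sub>0"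
    using assms(33,34) by (simp_all add: eq_neg_iff_add_eq_0)
  have "db g\<^sub>0 = db g\<^sub>0 \<cdot>\<^sub>r (inverse_in m g\<^sub>0 * g\<^sub>0)"
    using inverse_in[OF assms(13)] db_id[OF assms(12)] by simp
  then have bg\<^sub>0: "db g\<^sub>0 = d \<phi>\<^sub>0 \<cdot>\<^sub>r g\<^sub>0"
    by (simp add: d.ract_mult assms(14))
  \<comment> \<open>Only the inner factor is differentiated, since \<open>U\<^sub>0\<close>,
    \<open>V\<^sub>0\<close> and the identity are constant. The chosen Leibniz instances keep
    \<open>db (W * Y)\<close> intact for \<open>key\<close>.\<close>
  have bG: "db G = U\<^sub>0 \<cdot>\<^sub>l (db (W * Y) \<cdot>\<^sub>r V\<^sub>0)"
    unfolding G_def by (simp only: db.add db.Leibniz[of _ V\<^sub>0] db.Leibniz[of U\<^sub>0] assms(8,25,28))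
      (simp add: d.bimodule_simps)
  have "db G + (G \<cdot>\<^sub>l d \<phi>\<^sub>0) = d \<phi>\<^sub>0 + (U\<^sub>0 \<cdot>\<^sub>l ((db (W * Y) + ((W * Y) \<cdot>\<^sub>l \<beta>)) \<cdot>\<^sub>r V\<^sub>0))"
    unfolding bG unfolding G_def using d_id(1)[OF assms(11)]
    by (simp add: d.bimodule_simps Vd\<phi>\<^sub>0)
  \<comment> \<open>After \<open>key\<close>, the constraint on \<open>U\<^sub>0\<close> turns the
    \<open>\<alpha>\<close> term back into one with \<open>d \<phi>\<^sub>0\<close>, giving the
    expansion of \<open>d \<phi> \<cdot>\<^sub>r G\<close>.\<close>
  also have "\<dots> = d \<phi>\<^sub>0 + ((d \<phi>\<^sub>0 \<cdot>\<^sub>r U\<^sub>0) \<cdot>\<^sub>r ((W * Y) * V\<^sub>0)) + (U\<^sub>0 \<cdot>\<^sub>l (d W \<cdot>\<^sub>r V\<^sub>0))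
      + (U\<^sub>0 \<cdot>\<^sub>l (d W \<cdot>\<^sub>r (V\<^sub>0 * (U\<^sub>0 * (W * Y) * V\<^sub>0))))"
    unfolding key d\<phi>\<^sub>0U by (simp add: d.bimodule_simps)
  also have "\<dots> = d \<phi> \<cdot>\<^sub>r G"
  proof -
    have "d \<phi>\<^sub>0 \<cdot>\<^sub>r id_mat m = d \<phi>\<^sub>0" "V\<^sub>0 * id_mat m = V\<^sub>0"
      using d_id(2)[OF assms(11)] id_mat_mult(2)[OF assms(26)] by auto
    then show ?thesis
      unfolding d\<phi> G_def by (simp add: d.bimodule_simps d.ract_mult[of _ V\<^sub>0 "id_mat m", symmetric])
  qed
  \<comment> \<open>By the seed equation \<open>bg\<^sub>0\<close>,
    \<open>db (G * g\<^sub>0)\<close> is the left side of the chain times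
    \<open>g\<^sub>0\<close>.\<close>
  finally have "db g = d \<phi> \<cdot>\<^sub>r g"
    unfolding g db.Leibniz bg\<^sub>0 d.ract_mult by (simp flip: d.lact_ract d.ract_add_left)
  \<comment> \<open>The size of \<open>\<phi>\<close> makes
    \<open>d \<phi> \<cdot>\<^sub>r id_mat m\<close> equal to \<open>d \<phi>\<close> after
    multiplication by the inverse of \<open>g\<close>.\<close>
  moreover have "\<phi> \<in> Mat m m"
    unfolding assms(35) W_def[symmetric] using UW assms(11) by (rule Mat_add[rotated])
  ultimately have "db g \<cdot>\<^sub>r inverse_in m g = d \<phi>"
    using inverse_in[OF inv_g] d_id(2)[of \<phi> m m] by (simp flip: d.ract_mult)
  with inv_g show ?thesis by blast
qed

end
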